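(* Suppose $\mathcal{L}(\mathscr{D}_k,h_k)\le\epsilon$ for all $k\in\{1,\dots,p\}$ and $L(h_k(x),y)\le M$ for all $k$ and all $(x,y)\in\mathcal{X}\times\mathcal{Y}$ (the conditional distributions $\mathscr{D}_k(\cdot|x)$ of the sources may be distinct). Let $\mathscr{D}_T$ be an arbitrary (target) distribution on $\mathcal{X}\times\mathcal{Y}$ with conditional distributions $\mathscr{D}_T(\cdot|x)$. Then for any $\delta>0$ there exist $\eta>0$ and $z\in\Delta$ such that the following inequality holds for every $\alpha>1$: $$\mathcal{L}(\mathscr{D}_T,h_z^\eta)\le\Big[(\epsilon_T+\delta)\,\mathsf{d}_\alpha(\mathscr{D}_T\parallel\mathscr{D}_{P,T})\Big]^{\frac{\alpha-1}{\alpha}}M^{\frac1\alpha},$$ where $$\epsilon_T=\max_{k\in\{1,\dots,p\}}\Big[\mathbb{E}_{x\sim\mathscr{D}_k^1}\,\mathsf{d}_\alpha\big(\mathscr{D}_T(\cdot|x)\parallel\mathscr{D}_k(\cdot|x)\big)^{\alpha-1}\Big]^{\frac1\alpha}\epsilon^{\frac{\alpha-1}{\alpha}}M^{\frac1\alpha},$$ $\mathscr{D}_{k,T}(x,y)=\mathscr{D}_k^1(x)\,\mathscr{D}_T(y|x)$, and $\mathscr{D}_{P,T}=\big\{\sum_{k=1}^p\lambda_k\mathscr{D}_{k,T}:\lambda\in\Delta\big\}$.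
   Context: Setting: $\mathcal{X}$ is a nonempty finite set (input space); $\mathcal{Y}\subseteq\mathbb{R}$ is a nonempty convex set (output space); all probability distributions on $\mathcal{X}\times\mathcal{Y}$ and all conditional distributions on $\mathcal{Y}$ are finitely supported, so all sums over $\mathcal{Y}$ are finite sums. $\mathscr{U}^1$ is the uniform distribution on $\mathcal{X}$. $L:\mathcal{Y}\times\mathcal{Y}\to\mathbb{R}_+$ is a loss function that is continuous, and convex in its first argument. For a distribution $\mathscr{D}$ on $\mathcal{X}\times\mathcal{Y}$ and $h:\mathcal{X}\to\mathcal{Y}$, $\mathcal{L}(\mathscr{D},h)=\sum_{(x,y)}\mathscr{D}(x,y)L(h(x),y)$, and $\mathscr{D}^1(x)=\sum_{y}\mathscr{D}(x,y)$ is the marginal on $\mathcal{X}$. There are $p\ge1$ source distributions $\mathscr{D}_1,\dots,\mathscr{D}_p$ on $\mathcal{X}\times\mathcal{Y}$ and predictors $h_k:\mathcal{X}\to\mathcal{Y}$; $\epsilon>0$ and $M\ge0$ are constants. Conditional distributions are given for every $x\in\mathcal{X}$: $\mathscr{D}_k(x,y)=\mathscr{D}_k^1(x)\mathscr{D}_k(y|x)$ and $\mathscr{D}_T(x,y)=\mathscr{D}_T^1(x)\mathscr{D}_T(y|x)$, with $\mathscr{D}_k(\cdot|x)$, $\mathscr{D}_T(\cdot|x)$ probability distributions on $\mathcal{Y}$. $\Delta=\{\lambda\in\mathbb{R}^p:\lambda_k\ge0\ \forall k,\ \sum_k\lambda_k=1\}$. For $z\in\Delta$ and $\eta>0$, $$h_z^\eta(x)=\sum_{k=1}^p\frac{z_k\mathscr{D}_k^1(x)+\eta\,\mathscr{U}^1(x)/p}{\sum_{j=1}^pz_j\mathscr{D}_j^1(x)+\eta\,\mathscr{U}^1(x)}\,h_k(x).$$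 For $\alpha>1$ and finitely supported distributions $P,Q$ on the same set, the exponentiated Rényi divergence is $\mathsf{d}_\alpha(P\parallel Q)=\Big[\sum_{\omega}\frac{P(\omega)^\alpha}{Q(\omega)^{\alpha-1}}\Big]^{\frac1{\alpha-1}}\in[1,+\infty]$, where terms with $P(\omega)=0$ are $0$ and terms with $P(\omega)>0=Q(\omega)$ are $+\infty$. For a class of distributions $\mathcal{C}$, $\mathsf{d}_\alpha(P\parallel\mathcal{C})=\inf_{Q\in\mathcal{C}}\mathsf{d}_\alpha(P\parallel Q)$. The expectation over $x\sim\mathscr{D}_k^1$ only involves $x$ with $\mathscr{D}_k^1(x)>0$. Note that $\epsilon_T$ depends on $\alpha$. If one of the divergence quantities involved is $+\infty$ the inequality is regarded as trivially true. *)

theory Defs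
  imports "HOL-Probability.Probability"
begin

definition fin_dist :: "'a set \<Rightarrow> 'a pmf \<Rightarrow> bool" where
  "fin_dist S P \<longleftrightarrow> finite (set_pmf P) \<and> set_pmf P \<subseteq> S"

abbreviation marg :: "('x \<times> real) pmf \<Rightarrow> 'x pmf" where
  "marg D \<equiv> map_pmf fst D"

definition joint :: "'x pmf \<Rightarrow> ('x \<Rightarrow> real pmf) \<Rightarrow> ('x \<times> real) pmf" where
  "joint m C = bind_pmf m (\<lambda>x. map_pmf (Pair x) (C x))"

lemma pmf_joint: "pmf (joint m C) (x, y) = pmf m x * pmf (C x) y"
proof -
  have "pmf (map_pmf (Pair a) (C a)) (x, y) = indicator {x} a * pmf (C x) y" for a
  proof (cases "a = x")
    case True
    then show ?thesis using pmf_map_inj'[of "Pair x" "C x" y] by (simp add: inj_on_def)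
  next
    case False
    then have "(x, y) \<notin> set_pmf (map_pmf (Pair a) (C a))" by auto
    then have "pmf (map_pmf (Pair a) (C a)) (x, y) = 0" by (simp only: set_pmf_iff not_not)
    then show ?thesis using False by simp
  qed
  then show ?thesis
    by (simp add: joint_def pmf_bind measure_pmf_single)
qed

definition prob_simplex :: "nat \<Rightarrow> (nat \<Rightarrow> real) set" where
  "prob_simplex p = {l. (\<forall>k\<in>{1..p}. 0 \<le> l k) \<and> (\<Sum>k=1..p. l k) = 1}"

definition mixtures :: "nat \<Rightarrow> (nat \<Rightarrow> 'a pmf) \<Rightarrow> 'a pmf set" where
  "mixtures p D = {Q. \<exists>l\<in>prob_simplex p. \<forall>w. pmf Q w = (\<Sum>k=1..p. l k * pmf (D k) w)}"

text \<open>Every weight vector in the simplex is realised, so the set comprehension loses no mixture.\<close>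

lemma mixture_exists:
  assumes "l \<in> prob_simplex p"
  shows "\<exists>Q\<in>mixtures p D. \<forall>w. pmf Q w = (\<Sum>k=1..p. l k * pmf (D k) w)"
proof -
  have nn: "0 \<le> l k" if "k \<in> {1..p}" for k using assms that by (auto simp: prob_simplex_def)
  have s: "(\<Sum>k=1..p. l k) = 1" using assms by (simp add: prob_simplex_def)
  define f where "f w = (\<Sum>k=1..p. l k * pmf (D k) w)" for w
  have f0: "0 \<le> f w" for w unfolding f_def by (intro sum_nonneg mult_nonneg_nonneg nn) auto
  have "(\<integral>\<^sup>+ w. ennreal (f w) \<partial>count_space UNIV)
      = (\<integral>\<^sup>+ w. (\<Sum>k=1..p. ennreal (l k) * ennreal (pmf (D k) w)) \<partial>count_space UNIV)"
    unfolding f_def using nn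
    by (intro nn_integral_cong, subst sum_ennreal[symmetric])
      (auto simp: ennreal_mult' intro!: sum.cong)
  also have "\<dots> = (\<Sum>k=1..p. ennreal (l k) * (\<integral>\<^sup>+ w. ennreal (pmf (D k) w) \<partial>count_space UNIV))"
    by (simp add: nn_integral_sum nn_integral_cmult)
  also have "\<dots> = (\<Sum>k=1..p. ennreal (l k))" by (simp add: nn_integral_pmf_eq_1)
  also have "\<dots> = ennreal (\<Sum>k=1..p. l k)" by (intro sum_ennreal nn)
  also have "\<dots> = 1" using s by simp
  finally have "pmf (embed_pmf f) w = f w" for w by (intro pmf_embed_pmf f0)
  then show ?thesis using assms unfolding mixtures_def f_def by blast
qed

text \<open>Real powers of extended nonnegative reals; only positive exponents are used, for which
  the power of \<open>\<top>\<close> is \<open>\<top>\<close>.\<close>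

definition epowr :: "ennreal \<Rightarrow> real \<Rightarrow> ennreal" where
  "epowr t r = (if t = \<top> then \<top> else ennreal (enn2real t powr r))"

text \<open>In \<^typ>\<open>ennreal\<close>, \<open>t / 0 = \<top>\<close> for \<open>t > 0\<close>; hence a point charged by \<open>P\<close> but not by \<open>Q\<close>
  contributes \<open>\<top>\<close>. The sum is meant for finitely supported \<open>P\<close>.\<close>

definition exp_renyi :: "real \<Rightarrow> 'a pmf \<Rightarrow> 'a pmf \<Rightarrow> ennreal" where
  "exp_renyi \<alpha> P Q =
     epowr (\<Sum>w\<in>set_pmf P. ennreal (pmf P w powr \<alpha>) / ennreal (pmf Q w powr (\<alpha> - 1)))
           (1 / (\<alpha> - 1))"

definition exp_renyi_class :: "real \<Rightarrow> 'a pmf \<Rightarrow> 'a pmf set \<Rightarrow> ennreal" where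
  "exp_renyi_class \<alpha> P \<C> = (INF Q\<in>\<C>. exp_renyi \<alpha> P Q)"

definition exp_loss :: "(real \<Rightarrow> real \<Rightarrow> real) \<Rightarrow> ('x \<times> real) pmf \<Rightarrow> ('x \<Rightarrow> real) \<Rightarrow> real" where
  "exp_loss L D h = (\<Sum>(x, y)\<in>set_pmf D. pmf D (x, y) * L (h x) y)"

definition weighted_hyp ::
  "nat \<Rightarrow> (nat \<Rightarrow> ('x::finite \<times> real) pmf) \<Rightarrow> (nat \<Rightarrow> 'x \<Rightarrow> real) \<Rightarrow> real \<Rightarrow> (nat \<Rightarrow> real) \<Rightarrow> 'x \<Rightarrow> real"
where
  "weighted_hyp p D h \<eta> z x =
     (\<Sum>k=1..p. (z k * pmf (marg (D k)) x + \<eta> * pmf (pmf_of_set UNIV) x / real p)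
               / ((\<Sum>j=1..p. z j * pmf (marg (D j)) x) + \<eta> * pmf (pmf_of_set UNIV) x) * h k x)"

definition eps_T ::
  "nat \<Rightarrow> (nat \<Rightarrow> ('x \<times> real) pmf) \<Rightarrow> (nat \<Rightarrow> 'x \<Rightarrow> real pmf) \<Rightarrow> ('x \<Rightarrow> real pmf)
     \<Rightarrow> real \<Rightarrow> real \<Rightarrow> real \<Rightarrow> ennreal"
where
  "eps_T p D C CT \<epsilon> M \<alpha> =
     (MAX k\<in>{1..p}.
        epowr (\<integral>\<^sup>+ x. epowr (exp_renyi \<alpha> (CT x) (C k x)) (\<alpha> - 1) \<partial>measure_pmf (marg (D k))) (1 / \<alpha>)
        * ennreal (\<epsilon> powr ((\<alpha> - 1) / \<alpha>)) * ennreal (M powr (1 / \<alpha>)))"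

end

theory Submission
  imports Defs
begin

text \<open>
  Replacing every conditional of the sources by that of the target gives distributions
  \<open>D\<^bsub>k,T\<^esub>\<close> with a common conditional. For these, a Brouwer fixed point of
  \<open>z\<^sub>k \<mapsto> (z\<^sub>k g\<^sub>k(z) + c/p) / (\<Sum>\<^sub>j z\<^sub>j g\<^sub>j(z) + c)\<close>, where \<open>g\<^sub>k(z)\<close> is the loss of the weighted hypothesis
  on \<open>D\<^bsub>k,T\<^esub>\<close>, has all \<open>g\<^sub>k(z)\<close> below the average \<open>\<Sum>\<^sub>j z\<^sub>j g\<^sub>j(z)\<close> plus \<open>c\<close>, and by convexity
  this average is at most the worst loss of \<open>h\<^sub>k\<close> on \<open>D\<^bsub>k,T\<^esub>\<close>, up to \<open>\<eta> M\<close>. Nothing here involves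
  \<open>\<alpha>\<close>, so \<open>\<eta>\<close> and \<open>z\<close> are uniform in \<open>\<alpha>\<close>. The two changes of measure, from \<open>D\<^bsub>k,T\<^esub>\<close> to \<open>D\<^sub>k\<close> and
  from \<open>D\<^sub>T\<close> to a mixture of the \<open>D\<^bsub>k,T\<^esub>\<close>, are instances of Hoelder's inequality.
\<close>

subsection \<open>Brouwer's theorem for the probability simplex\<close>

text \<open>The library version of Brouwer's theorem fixes the dimension in a type of class
  \<^class>\<open>euclidean_space\<close>; here the dimension is a variable, so we start from \<open>kuhn_lemma\<close>.
  Sequential continuity in the relevant coordinates replaces a topology on functions.\<close>

lemma bounded_coordinates_convergent_subseq:
  fixes X :: "nat \<Rightarrow> nat \<Rightarrow> real"
  assumes "\<And>m i. i < n \<Longrightarrow> X m i \<in> {0..1}"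
  shows "\<exists>r l. strict_mono r \<and> (\<forall>i<n. (\<lambda>m. X (r m) i) \<longlonglongrightarrow> l i)"
  using assms
proof (induction n)
  case 0
  show ?case by (rule exI[of _ id]) (auto simp: strict_mono_def)
next
  case (Suc n)
  have "\<exists>r l. strict_mono r \<and> (\<forall>i<n. (\<lambda>m. X (r m) i) \<longlonglongrightarrow> l i)"
    by (rule Suc.IH, rule Suc.prems) simp
  then obtain r l where r: "strict_mono r" "\<And>i. i < n \<Longrightarrow> (\<lambda>m. X (r m) i) \<longlonglongrightarrow> l i"
    by blast
  \<comment> \<open>Coordinate \<open>n\<close> is treated after the first \<open>n\<close> ones: a
    further subsequence keeps the limits already found.\<close>
  have "bounded (range (\<lambda>m. X (r m) n))"
    using Suc.prems[of n] by (intro bounded_subset[OF bounded_closed_interval[of 0 1]]) auto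
  then obtain c s where s: "strict_mono s" "((\<lambda>m. X (r m) n) \<circ> s) \<longlonglongrightarrow> c"
    using bounded_imp_convergent_subsequence by blast
  show ?case
  proof (intro exI[of _ "r \<circ> s"] exI[of _ "l(n := c)"] conjI allI impI)
    show "strict_mono (r \<circ> s)" using r s by (simp add: strict_mono_o)
    show "(\<lambda>m. X ((r \<circ> s) m) i) \<longlonglongrightarrow> (l(n := c)) i" if "i < Suc n" for i
      using that s(2) LIMSEQ_subseq_LIMSEQ[OF r(2) s(1), of i]
      by (cases "i = n") (auto simp: o_def)
  qed
qed

text \<open>On the grid of mesh \<open>1 / Suc N\<close>, Kuhn's lemma finds a small cube on whose
  vertices the label of every coordinate takes both values. So for each \<open>i\<close> there is a
  vertex where \<open>f\<close> does not lower coordinate \<open>i\<close> and one where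
  \<open>f\<close> does not raise it, a discrete substitute for a fixed point. The two vertices may
  depend on \<open>i\<close>.\<close>

lemma kuhn_grid_point:
  fixes f :: "(nat \<Rightarrow> real) \<Rightarrow> nat \<Rightarrow> real"
  assumes maps: "\<And>x i. \<forall>j<n. x j \<in> {0..1} \<Longrightarrow> i < n \<Longrightarrow> f x i \<in> {0..1}"
  shows "\<exists>q. (\<forall>j<n. q j \<in> {0..1}) \<and> (\<forall>i<n. \<exists>a b.
           (\<forall>j<n. a j \<in> {0..1} \<and> \<bar>a j - q j\<bar> \<le> 1 / Suc N) \<and> a i \<le> f a i \<and>
           (\<forall>j<n. b j \<in> {0..1} \<and> \<bar>b j - q j\<bar> \<le> 1 / Suc N) \<and> f b i \<le> b i)"
proof -
  define v where "v x j = real (x j) / Suc N" for x :: "nat \<Rightarrow> nat" and j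
  \<comment> \<open>Label 0 means that \<open>f\<close> does not lower coordinate \<open>i\<close>.
    On the two opposite faces the label is prescribed by \<open>kuhn_lemma\<close>; there
    \<open>up\<close> and \<open>down\<close> hold because \<open>f\<close> maps into the
    cube.\<close>
  define label where
    "label x i = (if x i = 0 \<or> x i \<noteq> Suc N \<and> v x i \<le> f (v x) i then 0 else 1 :: nat)" for x i
  have v01: "\<forall>j<n. v x j \<in> {0..1}" if "\<forall>j<n. x j \<le> Suc N" for x
    using that by (auto simp: v_def divide_simps simp flip: of_nat_Suc)
  have fv01: "f (v x) i \<in> {0..1}" if "\<forall>j<n. x j \<le> Suc N" "i < n" for x i
    using maps[of "v x" i] v01[OF that(1)] that(2) by blast
  have up: "v x i \<le> f (v x) i" if "\<forall>j<n. x j \<le> Suc N" "i < n" "label x i = 0" for x i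
    using fv01[OF that(1,2)] that(3) by (auto simp: label_def v_def split: if_splits)
  have down: "f (v x) i \<le> v x i" if "\<forall>j<n. x j \<le> Suc N" "i < n" "label x i \<noteq> 0" for x i
    using fv01[OF that(1,2)] that(3) by (auto simp: label_def v_def split: if_splits)
  obtain q where q: "\<forall>i<n. q i < Suc N"
    and q': "\<forall>i<n. \<exists>r s. (\<forall>j<n. q j \<le> r j \<and> r j \<le> q j + 1) \<and>
              (\<forall>j<n. q j \<le> s j \<and> s j \<le> q j + 1) \<and> label r i \<noteq> label s i"
    by (rule kuhn_lemma[of "Suc N" n label]) (auto simp: label_def)
  have close: "\<bar>v r j - v q j\<bar> \<le> 1 / Suc N" if "q j \<le> r j" "r j \<le> q j + 1" for r j
    using that by (auto simp: v_def divide_simps simp flip: diff_divide_distrib)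
  have le: "\<forall>j<n. r j \<le> Suc N" if "\<forall>j<n. q j \<le> r j \<and> r j \<le> q j + 1" for r
  proof (intro allI impI)
    fix j assume "j < n"
    then have "r j \<le> q j + 1" "q j < Suc N" using that q by auto
    then show "r j \<le> Suc N" by simp
  qed
  show ?thesis
  proof (rule exI[of _ "v q"], intro conjI allI impI)
    show "v q j \<in> {0..1}" if "j < n" for j using v01[of q] q that by (auto simp: less_imp_le)
    fix i assume i: "i < n"
    then obtain r s where r: "\<forall>j<n. q j \<le> r j \<and> r j \<le> q j + 1"
      and s: "\<forall>j<n. q j \<le> s j \<and> s j \<le> q j + 1" and ne: "label r i \<noteq> label s i"
      using q' by blast
    have "label r i = 0 \<and> label s i \<noteq> 0 \<or> label s i = 0 \<and> label r i \<noteq> 0"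
      using ne by (auto simp: label_def split: if_splits)
    then obtain a b where a: "\<forall>j<n. q j \<le> a j \<and> a j \<le> q j + 1"
      and b: "\<forall>j<n. q j \<le> b j \<and> b j \<le> q j + 1" and l: "label a i = 0" "label b i \<noteq> 0"
      using r s by metis
    show "\<exists>a b. (\<forall>j<n. a j \<in> {0..1} \<and> \<bar>a j - v q j\<bar> \<le> 1 / Suc N) \<and> a i \<le> f a i \<and>
           (\<forall>j<n. b j \<in> {0..1} \<and> \<bar>b j - v q j\<bar> \<le> 1 / Suc N) \<and> f b i \<le> b i"
    proof (rule exI[of _ "v a"], rule exI[of _ "v b"], intro conjI)
      show "v a i \<le> f (v a) i" by (rule up[OF le[OF a] i l(1)])
      show "f (v b) i \<le> v b i" by (rule down[OF le[OF b] i l(2)])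
      show "\<forall>j<n. v a j \<in> {0..1} \<and> \<bar>v a j - v q j\<bar> \<le> 1 / Suc N"
        using v01[OF le[OF a]] close a by blast
      show "\<forall>j<n. v b j \<in> {0..1} \<and> \<bar>v b j - v q j\<bar> \<le> 1 / Suc N"
        using v01[OF le[OF b]] close b by blast
    qed
  qed
qed

text \<open>Along a convergent subsequence of the grid points both kinds of vertices tend to the
  same limit \<open>x\<close>, as the mesh vanishes. Continuity then turns their inequalities into
  \<open>x i \<le> f x i\<close> and \<open>f x i \<le> x i\<close>.\<close>

lemma brouwer_unit_cube_nat:
  fixes f :: "(nat \<Rightarrow> real) \<Rightarrow> nat \<Rightarrow> real"
  assumes maps: "\<And>x i. \<forall>j<n. x j \<in> {0..1} \<Longrightarrow> i < n \<Longrightarrow> f x i \<in> {0..1}"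
    and cont: "\<And>X l i. \<forall>m. \<forall>j<n. X m j \<in> {0..1} \<Longrightarrow> \<forall>j<n. (\<lambda>m. X m j) \<longlonglongrightarrow> l j \<Longrightarrow> i < n
                 \<Longrightarrow> (\<lambda>m. f (X m) i) \<longlonglongrightarrow> f l i"
  obtains x where "\<forall>j<n. x j \<in> {0..1}" "\<forall>j<n. f x j = x j"
proof -
  obtain q where q: "\<And>N j. j < n \<Longrightarrow> q N j \<in> {0..1}"
    and q': "\<And>N i. i < n \<Longrightarrow> \<exists>a b.
           (\<forall>j<n. a j \<in> {0..1} \<and> \<bar>a j - q N j\<bar> \<le> 1 / Suc N) \<and> a i \<le> f a i \<and>
           (\<forall>j<n. b j \<in> {0..1} \<and> \<bar>b j - q N j\<bar> \<le> 1 / Suc N) \<and> f b i \<le> b i"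
  proof -
    have "\<forall>N. \<exists>q. (\<forall>j<n. q j \<in> {0..1}) \<and> (\<forall>i<n. \<exists>a b.
           (\<forall>j<n. a j \<in> {0..1} \<and> \<bar>a j - q j\<bar> \<le> 1 / Suc N) \<and> a i \<le> f a i \<and>
           (\<forall>j<n. b j \<in> {0..1} \<and> \<bar>b j - q j\<bar> \<le> 1 / Suc N) \<and> f b i \<le> b i)"
      using kuhn_grid_point[of n f, OF maps] by blast
    from choice[OF this] show thesis using that by blast
  qed
  obtain r x where r: "strict_mono r" and lim: "\<And>j. j < n \<Longrightarrow> (\<lambda>m. q (r m) j) \<longlonglongrightarrow> x j"
    using bounded_coordinates_convergent_subseq[of n q] q by blast
  have near: "(\<lambda>m. A (r m) j) \<longlonglongrightarrow> x j"
    if "\<And>N. \<bar>A N j - q N j\<bar> \<le> 1 / Suc N" "j < n" for A :: "nat \<Rightarrow> nat \<Rightarrow> real" and j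
  proof -
    have "(\<lambda>N. A N j - q N j) \<longlonglongrightarrow> 0"
    proof (rule Lim_null_comparison)
      show "\<forall>\<^sub>F N in sequentially. norm (A N j - q N j) \<le> 1 / Suc N"
        using that(1) by simp
      show "(\<lambda>N. 1 / Suc N) \<longlonglongrightarrow> 0"
        using LIMSEQ_inverse_real_of_nat by (simp only: inverse_eq_divide)
    qed
    from tendsto_add[OF LIMSEQ_subseq_LIMSEQ[OF this r] lim[OF that(2)]]
    show ?thesis by (simp add: o_def)
  qed
  have x01: "\<forall>j<n. x j \<in> {0..1}"
    by (intro allI impI closed_sequentially[OF closed_real_atLeastAtMost _ lim] q)
  have "f x i = x i" if i: "i < n" for i
  proof -
    obtain A B where
      A: "\<And>N j. j < n \<Longrightarrow> A N j \<in> {0..1} \<and> \<bar>A N j - q N j\<bar> \<le> 1 / Suc N" "\<And>N. A N i \<le> f (A N) i" and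
      B: "\<And>N j. j < n \<Longrightarrow> B N j \<in> {0..1} \<and> \<bar>B N j - q N j\<bar> \<le> 1 / Suc N" "\<And>N. f (B N) i \<le> B N i"
      using q'[OF i] by metis
    have limA: "\<forall>j<n. (\<lambda>m. A (r m) j) \<longlonglongrightarrow> x j" and limB: "\<forall>j<n. (\<lambda>m. B (r m) j) \<longlonglongrightarrow> x j"
      using near A(1) B(1) by auto
    have "x i \<le> f x i"
      using cont[OF _ limA i] A limA i by (intro LIMSEQ_le[of "\<lambda>m. A (r m) i"]) auto
    moreover have "f x i \<le> x i"
      using cont[OF _ limB i] B limB i by (intro LIMSEQ_le[of _ _ "\<lambda>m. B (r m) i"]) auto
    ultimately show ?thesis by simp
  qed
  with x01 show thesis using that by blast
qed

text \<open>The cube is retracted onto the simplex by \<open>\<rho>\<close>, and the cube version is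
  applied to \<open>f\<close> after \<open>\<rho>\<close>. Up to the index shift, its fixed point is
  a value of \<open>f\<close>, so it lies in the simplex, where \<open>\<rho>\<close> changes
  nothing.\<close>

lemma brouwer_prob_simplex:
  fixes f :: "(nat \<Rightarrow> real) \<Rightarrow> nat \<Rightarrow> real"
  assumes p: "p \<ge> 1"
    and maps: "\<And>z. z \<in> prob_simplex p \<Longrightarrow> f z \<in> prob_simplex p"
    and cont: "\<And>Z l k. (\<And>m. Z m \<in> prob_simplex p) \<Longrightarrow> l \<in> prob_simplex p \<Longrightarrow>
                 (\<And>j. j \<in> {1..p} \<Longrightarrow> (\<lambda>m. Z m j) \<longlonglongrightarrow> l j) \<Longrightarrow> k \<in> {1..p}
                 \<Longrightarrow> (\<lambda>m. f (Z m) k) \<longlonglongrightarrow> f l k"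
  obtains z where "z \<in> prob_simplex p" "\<And>k. k \<in> {1..p} \<Longrightarrow> f z k = z k"
proof -
  define S where "S u = (\<Sum>j<p. u j)" for u :: "nat \<Rightarrow> real"
  \<comment> \<open>A sum below 1 is corrected by spreading the deficit evenly, a sum above 1 by
    rescaling; the denominator is at least 1 in both cases. The cube is indexed from 0 and the
    simplex from 1, hence \<open>k - 1\<close>.\<close>
  define \<rho> where "\<rho> u k = (u (k - 1) + max 0 (1 - S u) / p) / max 1 (S u)" for u k
  have sum_shift: "(\<Sum>k=1..p. g (k - 1)) = (\<Sum>j<p. g j)" for g :: "nat \<Rightarrow> real"
    by (rule sum.reindex_bij_witness[of _ Suc "\<lambda>k. k - 1"]) auto
  have \<rho>_simplex: "\<rho> u \<in> prob_simplex p" if "\<forall>j<p. u j \<in> {0..1}" for u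
  proof -
    have "(\<Sum>k=1..p. \<rho> u k) = (\<Sum>j<p. u j + max 0 (1 - S u) / p) / max 1 (S u)"
      unfolding \<rho>_def sum_shift[symmetric] by (simp add: sum_divide_distrib)
    also have "\<dots> = (S u + max 0 (1 - S u)) / max 1 (S u)"
      using p by (simp add: sum.distrib S_def)
    also have "\<dots> = 1" by (auto simp: max_def)
    finally show ?thesis
      using that by (auto simp: prob_simplex_def \<rho>_def intro!: divide_nonneg_nonneg add_nonneg_nonneg)
  qed
  have simplex_le1: "z k \<in> {0..1}" if "z \<in> prob_simplex p" "k \<in> {1..p}" for z k
    using that member_le_sum[of k "{1..p}" z] by (auto simp: prob_simplex_def)
  obtain u where u: "\<forall>j<p. u j \<in> {0..1}" and fix_u: "\<forall>j<p. f (\<rho> u) (Suc j) = u j"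
  proof (rule brouwer_unit_cube_nat[of p "\<lambda>u j. f (\<rho> u) (Suc j)"])
    show "f (\<rho> x) (Suc i) \<in> {0..1}" if "\<forall>j<p. x j \<in> {0..1}" "i < p" for x i
      using simplex_le1[OF maps[OF \<rho>_simplex[OF that(1)]], of "Suc i"] that(2) by auto
    fix X :: "nat \<Rightarrow> nat \<Rightarrow> real" and l :: "nat \<Rightarrow> real" and i
    assume X: "\<forall>m. \<forall>j<p. X m j \<in> {0..1}" and l: "\<forall>j<p. (\<lambda>m. X m j) \<longlonglongrightarrow> l j" and i: "i < p"
    have l01: "\<forall>j<p. l j \<in> {0..1}"
      using X l by (metis closed_sequentially closed_real_atLeastAtMost)
    have S: "(\<lambda>m. S (X m)) \<longlonglongrightarrow> S l"
      unfolding S_def using l by (intro tendsto_sum) auto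
    have "(\<lambda>m. \<rho> (X m) k) \<longlonglongrightarrow> \<rho> l k" if "k \<in> {1..p}" for k
      unfolding \<rho>_def using l that p by (intro tendsto_intros S) auto
    then show "(\<lambda>m. f (\<rho> (X m)) (Suc i)) \<longlonglongrightarrow> f (\<rho> l) (Suc i)"
      using X l01 i by (intro cont \<rho>_simplex) auto
  qed blast
  have fix': "f (\<rho> u) k = u (k - 1)" if "k \<in> {1..p}" for k
    using fix_u[rule_format, of "k - 1"] that by auto
  have "f (\<rho> u) \<in> prob_simplex p" by (intro maps \<rho>_simplex u)
  then have "(\<Sum>k=1..p. u (k - 1)) = 1" using fix' by (simp add: prob_simplex_def)
  then have "S u = 1" by (simp only: sum_shift S_def)
  then have "\<rho> u k = u (k - 1)" for k by (simp add: \<rho>_def)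
  with fix' show thesis using that[OF \<rho>_simplex[OF u]] by simp
qed

subsection \<open>Change of measure\<close>

text \<open>Meaningful only if \<open>P\<close> is absolutely continuous with respect to \<open>Q\<close>: a point with \<open>pmf Q w = 0\<close>
  contributes \<open>0\<close>, not \<open>\<top>\<close>.\<close>

definition renyi_sum :: "real \<Rightarrow> 'a pmf \<Rightarrow> 'a pmf \<Rightarrow> real" where
  "renyi_sum \<alpha> P Q = (\<Sum>w\<in>set_pmf P. pmf P w powr \<alpha> / pmf Q w powr (\<alpha> - 1))"

lemma renyi_sum_nonneg: "0 \<le> renyi_sum \<alpha> P Q"
  by (auto simp: renyi_sum_def intro!: sum_nonneg)

text \<open>A single point charged by \<open>P\<close> only makes the whole sum infinite. Finiteness
  of the divergence is thus what gives access to the real-valued \<open>renyi_sum\<close>.\<close>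

lemma set_pmf_subset_if_exp_renyi_finite:
  assumes "finite (set_pmf P)" "exp_renyi \<alpha> P Q < \<top>"
  shows "set_pmf P \<subseteq> set_pmf Q"
proof
  fix w assume w: "w \<in> set_pmf P"
  have "(\<Sum>w\<in>set_pmf P. ennreal (pmf P w powr \<alpha>) / ennreal (pmf Q w powr (\<alpha> - 1))) \<noteq> \<top>"
    using assms(2) by (auto simp: exp_renyi_def epowr_def split: if_splits)
  then have "ennreal (pmf P w powr \<alpha>) / ennreal (pmf Q w powr (\<alpha> - 1)) \<noteq> \<top>"
    using w assms(1) by auto
  then show "w \<in> set_pmf Q"
    using w by (auto simp: set_pmf_iff ennreal_divide_eq_top_iff)
qed

lemma exp_renyi_eq:
  assumes "finite (set_pmf P)" "set_pmf P \<subseteq> set_pmf Q"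
  shows "exp_renyi \<alpha> P Q = ennreal (renyi_sum \<alpha> P Q powr (1 / (\<alpha> - 1)))"
proof -
  have "(\<Sum>w\<in>set_pmf P. ennreal (pmf P w powr \<alpha>) / ennreal (pmf Q w powr (\<alpha> - 1)))
      = (\<Sum>w\<in>set_pmf P. ennreal (pmf P w powr \<alpha> / pmf Q w powr (\<alpha> - 1)))"
    using assms(2) by (intro sum.cong refl divide_ennreal) (auto simp: set_pmf_iff subset_iff)
  also have "\<dots> = ennreal (renyi_sum \<alpha> P Q)"
    unfolding renyi_sum_def by (intro sum_ennreal) auto
  finally show ?thesis
    unfolding exp_renyi_def by (simp add: epowr_def renyi_sum_nonneg)
qed

lemma epowr_ennreal [simp]: "0 \<le> t \<Longrightarrow> epowr (ennreal t) r = ennreal (t powr r)"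
  by (simp add: epowr_def)

text \<open>Young's inequality for \<open>P w / Q w\<close> against the constant \<open>c = A / F\<close>, summed with the
  weights \<open>Q w * f w\<close>; this choice of \<open>c\<close> is optimal.\<close>

lemma change_of_measure_renyi_sum:
  fixes f :: "'a \<Rightarrow> real"
  assumes finP: "finite (set_pmf P)" and finQ: "finite (set_pmf Q)"
    and sub: "set_pmf P \<subseteq> set_pmf Q" and \<alpha>: "\<alpha> > 1"
    and f: "\<And>w. w \<in> set_pmf Q \<Longrightarrow> 0 \<le> f w" "\<And>w. w \<in> set_pmf Q \<Longrightarrow> f w \<le> M"
  shows "(\<Sum>w\<in>set_pmf P. pmf P w * f w)
       \<le> renyi_sum \<alpha> P Q powr (1 / \<alpha>) * (\<Sum>w\<in>set_pmf Q. pmf Q w * f w) powr ((\<alpha> - 1) / \<alpha>)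
         * M powr (1 / \<alpha>)"
proof -
  define A where "A = (\<Sum>w\<in>set_pmf P. pmf P w * f w)"
  define F where "F = (\<Sum>w\<in>set_pmf Q. pmf Q w * f w)"
  define S where "S = renyi_sum \<alpha> P Q"
  have nn: "0 \<le> A" "0 \<le> F" "0 \<le> S"
    using f(1) sub by (auto simp: A_def F_def S_def renyi_sum_nonneg intro!: sum_nonneg)
  show ?thesis
  proof (cases "A = 0")
    case True
    then show ?thesis unfolding A_def[symmetric] by simp
  next
    case False
    then have A: "0 < A" using nn by simp
    obtain w where w: "w \<in> set_pmf P" "f w \<noteq> 0"
      using False unfolding A_def by (metis (no_types, lifting) sum.neutral mult_zero_right)
    \<comment> \<open>The point \<open>w\<close> is charged by \<open>P\<close>, hence by
      \<open>Q\<close>, and \<open>f\<close> is positive there; this allows division by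
      \<open>F\<close> in \<open>c\<close>.\<close>
    have F: "0 < F"
      unfolding F_def using w sub f(1) finQ
      by (intro sum_pos2[of _ w]) (auto simp: pmf_positive order.not_eq_order_implies_strict subset_iff)
    have M: "0 \<le> M" using f w sub by (meson order_trans subsetD)
    define c where "c = A / F"
    have c: "0 < c" using A F by (simp add: c_def)
    have conj: "\<alpha> / (\<alpha> - 1) > 1" "1 / \<alpha> + 1 / (\<alpha> / (\<alpha> - 1)) = 1" "(\<alpha> - 1) * (\<alpha> / (\<alpha> - 1)) = \<alpha>"
      using \<alpha> by (simp_all add: field_simps)
    have young: "t * c powr (\<alpha> - 1) \<le> t powr \<alpha> / \<alpha> + c powr \<alpha> * ((\<alpha> - 1) / \<alpha>)" if "0 \<le> t" for t
      using Youngs_inequality[of \<alpha> "\<alpha> / (\<alpha> - 1)" t "c powr (\<alpha> - 1)", OF \<alpha> conj(1,2) that]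
      using \<alpha> by (simp add: powr_powr conj(3))
    \<comment> \<open>Young's inequality at \<open>t = pmf P w / pmf Q w\<close>. Only its first
      term gives up \<open>f w\<close> for \<open>M\<close>; the second keeps \<open>f w\<close>, so
      that it sums to a multiple of \<open>F\<close>.\<close>
    have pt: "pmf P w * f w * c powr (\<alpha> - 1)
        \<le> M * (pmf P w powr \<alpha> / pmf Q w powr (\<alpha> - 1)) / \<alpha>
          + pmf Q w * f w * (c powr \<alpha> * ((\<alpha> - 1) / \<alpha>))" if w: "w \<in> set_pmf Q" for w
    proof -
      have Q: "0 < pmf Q w" using w by (simp add: pmf_positive)
      have "pmf P w * f w * c powr (\<alpha> - 1) = pmf Q w * f w * (pmf P w / pmf Q w * c powr (\<alpha> - 1))"
        using Q by simp
      also have "\<dots> \<le> pmf Q w * f w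
                       * ((pmf P w / pmf Q w) powr \<alpha> / \<alpha> + c powr \<alpha> * ((\<alpha> - 1) / \<alpha>))"
        using f(1)[OF w] by (intro mult_left_mono young) auto
      also have "\<dots> = f w * (pmf Q w * (pmf P w / pmf Q w) powr \<alpha>) / \<alpha>
                       + pmf Q w * f w * (c powr \<alpha> * ((\<alpha> - 1) / \<alpha>))"
        by (simp add: algebra_simps)
      also have "pmf Q w * (pmf P w / pmf Q w) powr \<alpha> = pmf P w powr \<alpha> / pmf Q w powr (\<alpha> - 1)"
        using Q by (simp add: powr_divide powr_diff)
      also have "f w * (pmf P w powr \<alpha> / pmf Q w powr (\<alpha> - 1)) / \<alpha>
               \<le> M * (pmf P w powr \<alpha> / pmf Q w powr (\<alpha> - 1)) / \<alpha>"
        using f(2)[OF w] \<alpha> by (intro divide_right_mono mult_right_mono) auto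
      finally show ?thesis by simp
    qed
    \<comment> \<open>Extending \<open>A\<close> and \<open>S\<close> to the support of
      \<open>Q\<close> adds only zeros; for \<open>S\<close> this rests on
      \<open>0 powr \<alpha> = 0\<close>.\<close>
    have A_eq: "A = (\<Sum>w\<in>set_pmf Q. pmf P w * f w)"
      unfolding A_def by (rule sum.mono_neutral_left) (use finQ sub in \<open>auto simp: set_pmf_iff\<close>)
    have S_eq: "S = (\<Sum>w\<in>set_pmf Q. pmf P w powr \<alpha> / pmf Q w powr (\<alpha> - 1))"
      unfolding S_def renyi_sum_def
      by (rule sum.mono_neutral_left) (use finQ sub in \<open>auto simp: set_pmf_iff\<close>)
    have "A * c powr (\<alpha> - 1) \<le> M * S / \<alpha> + F * (c powr \<alpha> * ((\<alpha> - 1) / \<alpha>))"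
      using sum_mono[of "set_pmf Q", OF pt]
      unfolding A_eq S_eq F_def
      by (simp only: sum.distrib sum_distrib_left sum_distrib_right sum_divide_distrib)
    \<comment> \<open>By the choice of \<open>c\<close>, the second Young term is the fraction
      \<open>(\<alpha> - 1) / \<alpha>\<close> of the left-hand side. Absorbing it leaves the factor
      \<open>1 / \<alpha>\<close> on both sides.\<close>
    moreover have cA: "F * c powr \<alpha> = A * c powr (\<alpha> - 1)"
      using A F by (simp add: powr_diff c_def)
    ultimately have "A * c powr (\<alpha> - 1) \<le> M * S / \<alpha> + A * c powr (\<alpha> - 1) * ((\<alpha> - 1) / \<alpha>)"
      by (simp only: mult.assoc[symmetric])
    then have "A * c powr (\<alpha> - 1) \<le> M * S"
      using \<alpha> by (simp add: field_simps)
    then have "A powr \<alpha> \<le> S * F powr (\<alpha> - 1) * M"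
      using A F by (simp add: c_def powr_divide powr_diff field_simps)
    then have "(A powr \<alpha>) powr (1 / \<alpha>) \<le> (S * F powr (\<alpha> - 1) * M) powr (1 / \<alpha>)"
      using \<alpha> by (intro powr_mono2) auto
    then show ?thesis
      using \<alpha> A nn M unfolding A_def[symmetric] F_def[symmetric] S_def[symmetric]
      by (simp add: powr_powr powr_mult)
  qed
qed

section \<open>Joint distributions with prescribed conditionals\<close>

lemma set_pmf_joint: "set_pmf (joint m C) = (SIGMA x:set_pmf m. set_pmf (C x))"
  by (auto simp: joint_def)

lemma sum_joint:
  fixes m :: "'x::finite pmf" and g :: "'x \<times> real \<Rightarrow> real"
  assumes "\<And>x. finite (set_pmf (C x))"
  shows "(\<Sum>w\<in>set_pmf (joint m C). g w) = (\<Sum>x\<in>set_pmf m. \<Sum>y\<in>set_pmf (C x). g (x, y))"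
  unfolding set_pmf_joint using assms by (subst sum.Sigma) (auto simp: case_prod_eta)

lemma exp_loss_joint:
  fixes m :: "'x::finite pmf"
  assumes "\<And>x. finite (set_pmf (C x))"
  shows "exp_loss L (joint m C) H
       = (\<Sum>x\<in>UNIV. pmf m x * (\<Sum>y\<in>set_pmf (C x). pmf (C x) y * L (H x) y))"
proof -
  have "exp_loss L (joint m C) H
      = (\<Sum>x\<in>set_pmf m. pmf m x * (\<Sum>y\<in>set_pmf (C x). pmf (C x) y * L (H x) y))"
    unfolding exp_loss_def sum_joint[OF assms] by (simp add: pmf_joint sum_distrib_left mult.assoc)
  also have "\<dots> = (\<Sum>x\<in>UNIV. pmf m x * (\<Sum>y\<in>set_pmf (C x). pmf (C x) y * L (H x) y))"
    by (rule sum.mono_neutral_left) (auto simp: set_pmf_iff)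
  finally show ?thesis .
qed

text \<open>The common marginal enters as
  \<open>pmf m x powr \<alpha> / pmf m x powr (\<alpha> - 1)\<close>, which collapses to
  \<open>pmf m x\<close>. What remains is an average of conditional sums, the expectation inside
  \<open>eps_T\<close>.\<close>

lemma renyi_sum_joint:
  fixes m :: "'x::finite pmf"
  assumes "\<And>x. finite (set_pmf (C x))"
  shows "renyi_sum \<alpha> (joint m C) (joint m C') = (\<Sum>x\<in>set_pmf m. pmf m x * renyi_sum \<alpha> (C x) (C' x))"
  unfolding renyi_sum_def sum_joint[OF assms] pmf_joint sum_distrib_left
  by (intro sum.cong refl) (simp add: powr_mult powr_diff pmf_positive set_pmf_iff less_le)

lemma change_of_measure_exp_loss:
  assumes "finite (set_pmf P)" "finite (set_pmf Q)" "set_pmf P \<subseteq> set_pmf Q" "\<alpha> > 1"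
    and "\<And>x y. (x, y) \<in> set_pmf Q \<Longrightarrow> 0 \<le> L (H x) y"
    and "\<And>x y. (x, y) \<in> set_pmf Q \<Longrightarrow> L (H x) y \<le> M"
  shows "exp_loss L P H
       \<le> renyi_sum \<alpha> P Q powr (1 / \<alpha>) * exp_loss L Q H powr ((\<alpha> - 1) / \<alpha>) * M powr (1 / \<alpha>)"
  using change_of_measure_renyi_sum[of P Q \<alpha> "\<lambda>w. L (H (fst w)) (snd w)" M] assms
  by (simp add: exp_loss_def case_prod_unfold)

subsection \<open>Weighted hypotheses\<close>

lemma prob_simplex_nonneg: "z \<in> prob_simplex p \<Longrightarrow> k \<in> {1..p} \<Longrightarrow> 0 \<le> z k"
  by (simp add: prob_simplex_def)

lemma prob_simplex_sum: "z \<in> prob_simplex p \<Longrightarrow> (\<Sum>k=1..p. z k) = 1"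
  by (simp add: prob_simplex_def)

text \<open>The uniform part is positive at every \<open>x\<close>. Hence the weights make sense
  even where no source has mass, and they depend continuously on \<open>z\<close>.\<close>

lemma weighted_hyp_denominator_pos:
  fixes D :: "nat \<Rightarrow> ('x::finite \<times> real) pmf"
  assumes "\<eta> > 0" "z \<in> prob_simplex p"
  shows "0 < (\<Sum>j=1..p. z j * pmf (marg (D j)) x) + \<eta> * pmf (pmf_of_set UNIV) x"
  using assms by (intro add_nonneg_pos sum_nonneg mult_nonneg_nonneg mult_pos_pos pmf_positive)
    (auto simp: prob_simplex_nonneg)

text \<open>The weights depend on \<open>x\<close>; multiplied by the denominator, as in the last
  clause, they become affine in \<open>z\<close>. In that form Jensen's inequality can be summed
  over \<open>x\<close>.\<close>

lemma weighted_hyp_convex_combination: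
  fixes D :: "nat \<Rightarrow> ('x::finite \<times> real) pmf"
  assumes p: "p \<ge> 1" and \<eta>: "\<eta> > 0" and z: "z \<in> prob_simplex p"
  obtains w where "\<And>k. k \<in> {1..p} \<Longrightarrow> 0 \<le> w k" "(\<Sum>k=1..p. w k) = 1"
    "weighted_hyp p D h \<eta> z x = (\<Sum>k=1..p. w k *\<^sub>R h k x)"
    "\<And>k. ((\<Sum>j=1..p. z j * pmf (marg (D j)) x) + \<eta> * pmf (pmf_of_set UNIV) x) * w k
         = z k * pmf (marg (D k)) x + \<eta> * pmf (pmf_of_set UNIV) x / p"
proof -
  define W where "W = (\<Sum>j=1..p. z j * pmf (marg (D j)) x) + \<eta> * pmf (pmf_of_set UNIV) x"
  define w where "w k = (z k * pmf (marg (D k)) x + \<eta> * pmf (pmf_of_set UNIV) x / p) / W" for k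
  have W: "0 < W" unfolding W_def by (rule weighted_hyp_denominator_pos[OF \<eta> z])
  show thesis
  proof
    show "0 \<le> w k" if "k \<in> {1..p}" for k
      using W \<eta> prob_simplex_nonneg[OF z that] unfolding w_def
      by (intro divide_nonneg_nonneg add_nonneg_nonneg mult_nonneg_nonneg) auto
    have "(\<Sum>k=1..p. w k) = W / W"
      using p unfolding w_def sum_divide_distrib[symmetric] sum.distrib by (simp add: W_def)
    then show "(\<Sum>k=1..p. w k) = 1" using W by simp
    show "weighted_hyp p D h \<eta> z x = (\<Sum>k=1..p. w k *\<^sub>R h k x)"
      by (simp add: weighted_hyp_def w_def W_def)
    show "((\<Sum>j=1..p. z j * pmf (marg (D j)) x) + \<eta> * pmf (pmf_of_set UNIV) x) * w k
         = z k * pmf (marg (D k)) x + \<eta> * pmf (pmf_of_set UNIV) x / p" for k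
      using W unfolding W_def[symmetric] by (simp add: w_def)
  qed
qed

lemma weighted_hyp_mem:
  fixes D :: "nat \<Rightarrow> ('x::finite \<times> real) pmf"
  assumes "p \<ge> 1" "\<eta> > 0" "z \<in> prob_simplex p" "convex Y" "\<And>k. k \<in> {1..p} \<Longrightarrow> h k x \<in> Y"
  shows "weighted_hyp p D h \<eta> z x \<in> Y"
proof -
  obtain w where w: "\<And>k. k \<in> {1..p} \<Longrightarrow> 0 \<le> w k" "(\<Sum>k=1..p. w k) = 1"
    "weighted_hyp p D h \<eta> z x = (\<Sum>k=1..p. w k *\<^sub>R h k x)"
    using weighted_hyp_convex_combination[OF assms(1-3), of D h x] by metis
  show ?thesis unfolding w(3) using w assms by (intro convex_sum) auto
qed

text \<open>The bound \<open>M\<close> is given for each \<open>h k\<close>; convexity transfers it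
  to the combined hypothesis, for which the change of measure to a mixture requires it.\<close>

lemma weighted_hyp_le_bound:
  fixes D :: "nat \<Rightarrow> ('x::finite \<times> real) pmf"
  assumes "p \<ge> 1" "\<eta> > 0" "z \<in> prob_simplex p" and f: "convex_on Y f"
    and h: "\<And>k. k \<in> {1..p} \<Longrightarrow> h k x \<in> Y" and M: "\<And>k. k \<in> {1..p} \<Longrightarrow> f (h k x) \<le> M"
  shows "f (weighted_hyp p D h \<eta> z x) \<le> M"
proof -
  obtain w where w: "\<And>k. k \<in> {1..p} \<Longrightarrow> 0 \<le> w k" "(\<Sum>k=1..p. w k) = 1"
    "weighted_hyp p D h \<eta> z x = (\<Sum>k=1..p. w k *\<^sub>R h k x)"
    using weighted_hyp_convex_combination[OF assms(1-3), of D h x] by metis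
  have "f (\<Sum>k=1..p. w k *\<^sub>R h k x) \<le> (\<Sum>k=1..p. w k * f (h k x))"
    by (rule convex_on_sum[OF _ _ f w(2)]) (use w h assms(1) in auto)
  also have "\<dots> \<le> (\<Sum>k=1..p. w k * M)"
    by (intro sum_mono mult_left_mono M w)
  also have "\<dots> = M" using w(2) by (simp flip: sum_distrib_right)
  finally show ?thesis unfolding w(3) .
qed

lemma weighted_hyp_jensen:
  fixes D :: "nat \<Rightarrow> ('x::finite \<times> real) pmf"
  assumes "p \<ge> 1" "\<eta> > 0" "z \<in> prob_simplex p" and f: "convex_on Y f"
    and h: "\<And>k. k \<in> {1..p} \<Longrightarrow> h k x \<in> Y"
  shows "((\<Sum>j=1..p. z j * pmf (marg (D j)) x) + \<eta> * pmf (pmf_of_set UNIV) x)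
           * f (weighted_hyp p D h \<eta> z x)
       \<le> (\<Sum>k=1..p. (z k * pmf (marg (D k)) x + \<eta> * pmf (pmf_of_set UNIV) x / p) * f (h k x))"
    (is "?W * _ \<le> _")
proof (rule weighted_hyp_convex_combination[OF assms(1-3), of D h x])
  fix w assume w: "\<And>k. k \<in> {1..p} \<Longrightarrow> 0 \<le> w k" "(\<Sum>k=1..p. w k) = 1"
    "weighted_hyp p D h \<eta> z x = (\<Sum>k=1..p. w k *\<^sub>R h k x)"
    and Ww: "\<And>k. ?W * w k = z k * pmf (marg (D k)) x + \<eta> * pmf (pmf_of_set UNIV) x / p"
  have "f (\<Sum>k=1..p. w k *\<^sub>R h k x) \<le> (\<Sum>k=1..p. w k * f (h k x))"
    by (rule convex_on_sum[OF _ _ f w(2)]) (use w h assms(1) in auto)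
  then have "?W * f (weighted_hyp p D h \<eta> z x) \<le> ?W * (\<Sum>k=1..p. w k * f (h k x))"
    unfolding w(3) using weighted_hyp_denominator_pos[OF assms(2,3), of D x]
    by (intro mult_left_mono) auto
  also have "\<dots> = (\<Sum>k=1..p. ?W * w k * f (h k x))"
    by (simp only: sum_distrib_left mult.assoc)
  finally show ?thesis unfolding Ww .
qed

lemma tendsto_weighted_hyp:
  fixes D :: "nat \<Rightarrow> ('x::finite \<times> real) pmf"
  assumes "\<eta> > 0" "l \<in> prob_simplex p"
    and "\<And>j. j \<in> {1..p} \<Longrightarrow> (\<lambda>m. Z m j) \<longlonglongrightarrow> l j"
  shows "(\<lambda>m. weighted_hyp p D h \<eta> (Z m) x) \<longlonglongrightarrow> weighted_hyp p D h \<eta> l x"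
  unfolding weighted_hyp_def
  using assms(3) weighted_hyp_denominator_pos[OF assms(1,2), of D x]
  by (intro tendsto_intros tendsto_sum) auto

text \<open>The loss \<open>ls\<close> carries no index \<open>k\<close>: thanks to the common
  conditional, one use of Jensen's inequality at each \<open>x\<close> treats all sources together.
  This bounds the average \<open>G z\<close>, and the fixed-point equation passes from the average
  to every \<open>g k z\<close>.\<close>

lemma exists_robust_weights:
  fixes D :: "nat \<Rightarrow> ('x::finite \<times> real) pmf" and ls :: "'x \<Rightarrow> real \<Rightarrow> real"
  assumes p: "p \<ge> 1" and Y: "convex Y"
    and cont: "\<And>x. continuous_on Y (ls x)" and conv: "\<And>x. convex_on Y (ls x)"
    and nonneg: "\<And>x a. a \<in> Y \<Longrightarrow> 0 \<le> ls x a"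
    and h: "\<And>k x. k \<in> {1..p} \<Longrightarrow> h k x \<in> Y"
    and M: "\<And>k x. k \<in> {1..p} \<Longrightarrow> ls x (h k x) \<le> M"
    and B: "\<And>k. k \<in> {1..p} \<Longrightarrow> (\<Sum>x\<in>UNIV. pmf (marg (D k)) x * ls x (h k x)) \<le> B"
    and \<delta>: "\<delta> > 0"
  shows "\<exists>\<eta>>0. \<exists>z\<in>prob_simplex p. \<forall>k\<in>{1..p}.
           (\<Sum>x\<in>UNIV. pmf (marg (D k)) x * ls x (weighted_hyp p D h \<eta> z x)) \<le> B + \<delta>"
proof -
  have M0: "0 \<le> M" using nonneg[OF h, of 1] M[of 1] p by (meson atLeastAtMost_iff le_refl order_trans)
  \<comment> \<open>One half of \<open>\<delta>\<close> pays for the smoothing, which costs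
    \<open>\<eta> * M\<close>; the other half is the shift \<open>c\<close> in the fixed-point map.
    Taking \<open>M + 1\<close> avoids a zero denominator.\<close>
  define \<eta> where "\<eta> = \<delta> / (2 * (M + 1))"
  define c where "c = \<delta> / 2"
  have \<eta>: "\<eta> > 0" and c: "c > 0" and \<eta>M: "\<eta> * M \<le> c"
    using \<delta> M0 by (auto simp: \<eta>_def c_def field_simps)
  define H where "H = weighted_hyp p D h \<eta>"
  define m where "m k x = pmf (marg (D k)) x" for k x
  define U where "U x = pmf (pmf_of_set (UNIV :: 'x set)) x" for x
  define g where "g k z = (\<Sum>x\<in>UNIV. m k x * ls x (H z x))" for k z
  define G where "G z = (\<Sum>j=1..p. z j * g j z)" for z
  \<comment> \<open>The numerators add up to \<open>G z + c\<close>, so \<open>\<phi>\<close> stays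
    in the simplex. A positive \<open>c\<close> keeps the denominator away from 0 and excludes zero
    coordinates at a fixed point.\<close>
  define \<phi> where "\<phi> z k = (z k * g k z + c / p) / (G z + c)" for z k
  have HY: "H z x \<in> Y" if "z \<in> prob_simplex p" for z x
    unfolding H_def by (rule weighted_hyp_mem[OF p \<eta> that Y h])
  have g0: "0 \<le> g k z" if "z \<in> prob_simplex p" for k z
    unfolding g_def using HY[OF that] by (intro sum_nonneg mult_nonneg_nonneg nonneg) (auto simp: m_def)
  have G0: "0 \<le> G z" if "z \<in> prob_simplex p" for z
    unfolding G_def by (intro sum_nonneg mult_nonneg_nonneg g0[OF that] prob_simplex_nonneg[OF that])
  obtain z where z: "z \<in> prob_simplex p" and fix_z: "\<And>k. k \<in> {1..p} \<Longrightarrow> \<phi> z k = z k"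
  proof (rule brouwer_prob_simplex[OF p, of \<phi>])
    fix z assume z: "z \<in> prob_simplex p"
    have "(\<Sum>k=1..p. \<phi> z k) = (G z + c) / (G z + c)"
      unfolding \<phi>_def sum_divide_distrib[symmetric] sum.distrib using p by (simp add: G_def)
    also have "\<dots> = 1" using G0[OF z] c by simp
    finally show "\<phi> z \<in> prob_simplex p"
      using g0[OF z] G0[OF z] c z
      by (auto simp: prob_simplex_def \<phi>_def intro!: divide_nonneg_nonneg add_nonneg_nonneg)
  next
    fix Z l k assume Z: "\<And>m. Z m \<in> prob_simplex p" and l: "l \<in> prob_simplex p"
      and lim: "\<And>j. j \<in> {1..p} \<Longrightarrow> (\<lambda>m. Z m j) \<longlonglongrightarrow> l j" and k: "k \<in> {1..p}"
    have "(\<lambda>m. ls x (H (Z m) x)) \<longlonglongrightarrow> ls x (H l x)" for x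
      using tendsto_weighted_hyp[OF \<eta> l lim, of D h x] HY[OF Z] HY[OF l]
      by (intro continuous_on_tendsto_compose[OF cont]) (auto simp: H_def)
    then have g: "(\<lambda>m. g j (Z m)) \<longlonglongrightarrow> g j l" for j
      unfolding g_def by (intro tendsto_intros)
    then have "(\<lambda>m. G (Z m)) \<longlonglongrightarrow> G l"
      unfolding G_def by (intro tendsto_sum tendsto_mult lim)
    then show "(\<lambda>m. \<phi> (Z m) k) \<longlonglongrightarrow> \<phi> l k"
      unfolding \<phi>_def using g lim[OF k] G0[OF l] c by (intro tendsto_intros) auto
  qed blast
  \<comment> \<open>Exchanging the sums gives one sum over \<open>x\<close> against the mixed
    marginal. Adding the nonnegative \<open>\<eta> * U x\<close> part completes it to the
    denominator of the weighted hypothesis, ready for Jensen.\<close>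
  have "G z = (\<Sum>x\<in>UNIV. (\<Sum>j=1..p. z j * m j x) * ls x (H z x))"
    unfolding G_def g_def sum_distrib_left sum_distrib_right
    by (subst sum.swap) (simp add: mult.assoc)
  also have "\<dots> \<le> (\<Sum>x\<in>UNIV. ((\<Sum>j=1..p. z j * m j x) + \<eta> * U x) * ls x (H z x))"
    using \<eta> nonneg[OF HY[OF z]] by (intro sum_mono mult_right_mono) (auto simp: U_def)
  also have "\<dots> \<le> (\<Sum>x\<in>UNIV. \<Sum>k=1..p. (z k * m k x + \<eta> * U x / p) * ls x (h k x))"
    unfolding m_def U_def H_def by (intro sum_mono weighted_hyp_jensen[OF p \<eta> z conv h])
  \<comment> \<open>The uniform part is estimated crudely by \<open>M\<close>; the source part keeps
    its losses, which \<open>B\<close> controls.\<close>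
  also have "\<dots> \<le> (\<Sum>x\<in>UNIV. \<Sum>k=1..p. z k * (m k x * ls x (h k x)) + \<eta> * U x / p * M)"
    unfolding distrib_right mult.assoc
    by (intro sum_mono add_mono order_refl) (use M \<eta> p in \<open>auto simp: U_def field_simps intro!: mult_left_mono\<close>)
  also have "\<dots> = (\<Sum>k=1..p. z k * (\<Sum>x\<in>UNIV. m k x * ls x (h k x))) + \<eta> * M * (\<Sum>x\<in>UNIV. U x)"
  proof -
    have "(\<Sum>k=1..p. \<eta> * U x / p * M) = \<eta> * M * U x" for x using p by simp
    then show ?thesis
      unfolding sum.distrib sum_distrib_left
      by (subst sum.swap) (simp add: mult.assoc)
  qed
  also have "(\<Sum>x\<in>UNIV. U x) = 1" unfolding U_def by (rule sum_pmf_eq_1) auto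
  also have "(\<Sum>k=1..p. z k * (\<Sum>x\<in>UNIV. m k x * ls x (h k x))) \<le> (\<Sum>k=1..p. z k * B)"
    unfolding m_def by (intro sum_mono mult_left_mono B prob_simplex_nonneg[OF z])
  also have "(\<Sum>k=1..p. z k * B) = B"
    using prob_simplex_sum[OF z] by (simp flip: sum_distrib_right)
  finally have GB: "G z \<le> B + c" using \<eta>M by simp
  have "g k z \<le> B + \<delta>" if k: "k \<in> {1..p}" for k
  proof -
    have Gc: "0 < G z + c" using G0[OF z] c by simp
    \<comment> \<open>In this cleared form \<open>z k = 0\<close> would contradict
      \<open>c / p > 0\<close>. Dropping \<open>c / p\<close> and dividing by \<open>z k\<close>
      leaves \<open>g k z \<le> G z + c\<close>.\<close>
    have eq: "z k * g k z + c / p = z k * (G z + c)"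
      using fix_z[OF k] Gc by (simp add: \<phi>_def field_simps)
    have cp: "0 < c / p" using c p by simp
    have "z k \<noteq> 0" using eq cp by auto
    then have "0 < z k" using prob_simplex_nonneg[OF z k] by simp
    moreover have "z k * g k z \<le> z k * (G z + c)" using eq cp by linarith
    ultimately have "g k z \<le> G z + c" by simp
    with GB show ?thesis by (simp add: c_def)
  qed
  with z \<eta> show ?thesis unfolding g_def m_def H_def by blast
qed

section \<open>Loss bounds in terms of Renyi divergences\<close>

lemma nn_integral_exp_renyi_conditionals:
  fixes m :: "'x::finite pmf"
  assumes "\<alpha> > 1" and fin: "\<And>x. finite (set_pmf (C x))"
    and "\<And>x. x \<in> set_pmf m \<Longrightarrow> exp_renyi \<alpha> (C x) (C' x) < \<top>"
  shows "(\<integral>\<^sup>+ x. epowr (exp_renyi \<alpha> (C x) (C' x)) (\<alpha> - 1) \<partial>measure_pmf m)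
       = ennreal (renyi_sum \<alpha> (joint m C) (joint m C'))"
proof -
  have "(\<integral>\<^sup>+ x. epowr (exp_renyi \<alpha> (C x) (C' x)) (\<alpha> - 1) \<partial>measure_pmf m)
      = (\<Sum>x\<in>set_pmf m. epowr (exp_renyi \<alpha> (C x) (C' x)) (\<alpha> - 1) * pmf m x)"
    by (rule nn_integral_measure_pmf_finite) simp_all
  also have "\<dots> = (\<Sum>x\<in>set_pmf m. ennreal (pmf m x * renyi_sum \<alpha> (C x) (C' x)))"
  proof (intro sum.cong refl)
    fix x assume "x \<in> set_pmf m"
    then have sub: "set_pmf (C x) \<subseteq> set_pmf (C' x)"
      using assms set_pmf_subset_if_exp_renyi_finite by blast
    \<comment> \<open>The powers \<open>1 / (\<alpha> - 1)\<close> and \<open>\<alpha> - 1\<close>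
      cancel, leaving the bare sum.\<close>
    show "epowr (exp_renyi \<alpha> (C x) (C' x)) (\<alpha> - 1) * ennreal (pmf m x)
        = ennreal (pmf m x * renyi_sum \<alpha> (C x) (C' x))"
      using assms(1) renyi_sum_nonneg[of \<alpha> "C x" "C' x"]
      by (simp add: exp_renyi_eq[OF fin sub] powr_powr ennreal_mult' mult.commute)
  qed
  also have "\<dots> = ennreal (renyi_sum \<alpha> (joint m C) (joint m C'))"
    unfolding renyi_sum_joint[OF fin] by (intro sum_ennreal) (auto simp: renyi_sum_nonneg)
  finally show ?thesis .
qed

lemma set_pmf_mixture:
  fixes D :: "nat \<Rightarrow> 'a pmf"
  assumes Q: "\<And>w. pmf Q w = (\<Sum>k=1..p. l k * pmf (D k) w)"
  shows "set_pmf Q \<subseteq> (\<Union>k\<in>{1..p}. set_pmf (D k))"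
proof
  fix w assume "w \<in> set_pmf Q"
  then obtain k where "k \<in> {1..p}" "l k * pmf (D k) w \<noteq> 0"
    by (metis (no_types, lifting) Q set_pmf_iff sum.neutral)
  then show "w \<in> (\<Union>k\<in>{1..p}. set_pmf (D k))" by (auto simp: set_pmf_iff)
qed

lemma exp_loss_mixture:
  fixes D :: "nat \<Rightarrow> ('x \<times> real) pmf"
  assumes fin: "\<And>k. k \<in> {1..p} \<Longrightarrow> finite (set_pmf (D k))"
    and Q: "\<And>w. pmf Q w = (\<Sum>k=1..p. l k * pmf (D k) w)"
  shows "exp_loss L Q H = (\<Sum>k=1..p. l k * exp_loss L (D k) H)"
proof -
  \<comment> \<open>The supports of the mixture and of its components may differ; over the common
    finite set \<open>W\<close> the loss is visibly linear in the distribution.\<close>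
  define W where "W = (\<Union>k\<in>{1..p}. set_pmf (D k))"
  have W: "finite W" unfolding W_def by (intro finite_UN_I finite_atLeastAtMost fin)
  have QW: "set_pmf Q \<subseteq> W" unfolding W_def by (rule set_pmf_mixture[OF Q])
  have ext: "exp_loss L P H = (\<Sum>w\<in>W. pmf P w * L (H (fst w)) (snd w))" if "set_pmf P \<subseteq> W" for P
    unfolding exp_loss_def case_prod_unfold
    by (simp, rule sum.mono_neutral_left) (use W that in \<open>auto simp: set_pmf_iff\<close>)
  have "exp_loss L (D k) H = (\<Sum>w\<in>W. pmf (D k) w * L (H (fst w)) (snd w))" if "k \<in> {1..p}" for k
    by (rule ext) (use that in \<open>auto simp: W_def\<close>)
  then have "(\<Sum>k=1..p. l k * exp_loss L (D k) H)
      = (\<Sum>k=1..p. \<Sum>w\<in>W. l k * pmf (D k) w * L (H (fst w)) (snd w))"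
    by (intro sum.cong refl) (simp add: sum_distrib_left mult.assoc)
  also have "\<dots> = exp_loss L Q H"
    unfolding ext[OF QW] Q sum_distrib_right by (rule sum.swap)
  finally show ?thesis by simp
qed

text \<open>Replacing the target conditional by \<open>C k\<close> keeps the marginal of
  \<open>D k\<close>, so the change of measure costs exactly the expectation in
  \<open>eps_T\<close>; bounding the source loss by \<open>\<epsilon>\<close> gives the
  \<open>k\<close>-th term of the maximum. Finiteness is recorded so that \<open>eps_T\<close> can
  be treated as a real number.\<close>

lemma exp_loss_le_eps_T:
  fixes D :: "nat \<Rightarrow> ('x::finite \<times> real) pmf"
  assumes p: "p \<ge> 1" and \<alpha>: "\<alpha> > 1"
    and finC: "\<And>k x. k \<in> {1..p} \<Longrightarrow> finite (set_pmf (C k x))" and finCT: "\<And>x. finite (set_pmf (CT x))"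
    and D: "\<And>k. k \<in> {1..p} \<Longrightarrow> D k = joint (marg (D k)) (C k)"
    and L0: "\<And>k x y. k \<in> {1..p} \<Longrightarrow> (x, y) \<in> set_pmf (D k) \<Longrightarrow> 0 \<le> L (h k x) y"
    and LM: "\<And>k x y. k \<in> {1..p} \<Longrightarrow> (x, y) \<in> set_pmf (D k) \<Longrightarrow> L (h k x) y \<le> M"
    and loss: "\<And>k. k \<in> {1..p} \<Longrightarrow> exp_loss L (D k) (h k) \<le> \<epsilon>"
    and fin: "\<And>k x. k \<in> {1..p} \<Longrightarrow> x \<in> set_pmf (marg (D k)) \<Longrightarrow> exp_renyi \<alpha> (CT x) (C k x) < \<top>"
  shows "eps_T p D C CT \<epsilon> M \<alpha> < \<top>"
    and "\<And>k. k \<in> {1..p} \<Longrightarrow>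
           ennreal (exp_loss L (joint (marg (D k)) CT) (h k)) \<le> eps_T p D C CT \<epsilon> M \<alpha>"
proof -
  define S where "S k = renyi_sum \<alpha> (joint (marg (D k)) CT) (D k)" for k
  define T where "T k = S k powr (1 / \<alpha>) * \<epsilon> powr ((\<alpha> - 1) / \<alpha>) * M powr (1 / \<alpha>)" for k
  have S0: "0 \<le> S k" for k by (simp add: S_def renyi_sum_nonneg)
  have "(\<integral>\<^sup>+ x. epowr (exp_renyi \<alpha> (CT x) (C k x)) (\<alpha> - 1) \<partial>measure_pmf (marg (D k)))
      = ennreal (S k)" if k: "k \<in> {1..p}" for k
    using nn_integral_exp_renyi_conditionals[where m = "marg (D k)" and C' = "C k", OF \<alpha> finCT fin[OF k]]
    unfolding S_def by (simp only: D[OF k, symmetric])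
  then have "(\<lambda>k. epowr (\<integral>\<^sup>+ x. epowr (exp_renyi \<alpha> (CT x) (C k x)) (\<alpha> - 1) \<partial>measure_pmf (marg (D k))) (1 / \<alpha>)
               * ennreal (\<epsilon> powr ((\<alpha> - 1) / \<alpha>)) * ennreal (M powr (1 / \<alpha>))) ` {1..p}
      = (\<lambda>k. ennreal (T k)) ` {1..p}"
    by (intro image_cong refl) (simp add: S0 T_def ennreal_mult')
  then have eps: "eps_T p D C CT \<epsilon> M \<alpha> = (MAX k\<in>{1..p}. ennreal (T k))"
    unfolding eps_T_def by (rule arg_cong)
  show "eps_T p D C CT \<epsilon> M \<alpha> < \<top>"
    unfolding eps using p by (subst Max_less_iff) auto
  fix k assume k: "k \<in> {1..p}"
  have sub: "set_pmf (CT x) \<subseteq> set_pmf (C k x)" if "x \<in> set_pmf (marg (D k))" for x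
    by (rule set_pmf_subset_if_exp_renyi_finite[OF finCT fin[OF k that]])
  have "set_pmf (joint (marg (D k)) CT) \<subseteq> set_pmf (joint (marg (D k)) (C k))"
    unfolding set_pmf_joint using sub by blast
  then have sub': "set_pmf (joint (marg (D k)) CT) \<subseteq> set_pmf (D k)"
    using D[OF k] by simp
  have "finite (set_pmf (joint (marg (D k)) (C k)))"
    unfolding set_pmf_joint using finC[OF k] by auto
  then have finD: "finite (set_pmf (D k))" using D[OF k] by simp
  have "exp_loss L (joint (marg (D k)) CT) (h k)
      \<le> S k powr (1 / \<alpha>) * exp_loss L (D k) (h k) powr ((\<alpha> - 1) / \<alpha>) * M powr (1 / \<alpha>)"
    unfolding S_def using L0[OF k] LM[OF k]
    by (intro change_of_measure_exp_loss finite_subset[OF sub' finD] finD sub' \<alpha>) auto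
  also have "\<dots> \<le> T k"
  proof -
    have "0 \<le> exp_loss L (D k) (h k)"
      unfolding exp_loss_def using L0[OF k] by (auto intro!: sum_nonneg)
    then show ?thesis
      unfolding T_def using loss[OF k] \<alpha> by (intro mult_right_mono mult_left_mono powr_mono2) auto
  qed
  finally show "ennreal (exp_loss L (joint (marg (D k)) CT) (h k)) \<le> eps_T p D C CT \<epsilon> M \<alpha>"
    unfolding eps using k by (intro Max_ge_iff[THEN iffD2]) (auto intro!: bexI[of _ k] ennreal_leI)
qed

text \<open>To reach the infimum, the bound for each \<open>Q\<close> is inverted into a lower bound
  \<open>t\<close> on its divergence. The infimum is then at least \<open>t\<close>, and
  monotonicity gives the claim back.\<close>

lemma exp_loss_le_exp_renyi_class:
  assumes \<alpha>: "\<alpha> > 1" and c: "c > 0" and finP: "finite (set_pmf P)"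
    and finQ: "\<And>Q. Q \<in> \<C> \<Longrightarrow> finite (set_pmf Q)"
    and L0: "\<And>Q x y. Q \<in> \<C> \<Longrightarrow> (x, y) \<in> set_pmf Q \<Longrightarrow> 0 \<le> L (H x) y"
    and LM: "\<And>Q x y. Q \<in> \<C> \<Longrightarrow> (x, y) \<in> set_pmf Q \<Longrightarrow> L (H x) y \<le> M"
    and loss: "\<And>Q. Q \<in> \<C> \<Longrightarrow> exp_loss L Q H \<le> c"
    and fin: "exp_renyi_class \<alpha> P \<C> < \<top>"
  shows "ennreal (exp_loss L P H)
       \<le> epowr (ennreal c * exp_renyi_class \<alpha> P \<C>) ((\<alpha> - 1) / \<alpha>) * ennreal (M powr (1 / \<alpha>))"
proof -
  define A where "A = exp_loss L P H"
  define r where "r = (\<alpha> - 1) / \<alpha>"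
  define \<mu> where "\<mu> = M powr (1 / \<alpha>)"
  have r: "0 < r" using \<alpha> by (simp add: r_def)
  have bound: "A \<le> (c * d) powr r * \<mu>" if Q: "Q \<in> \<C>" and d: "exp_renyi \<alpha> P Q = ennreal d" "0 \<le> d" for Q d
  proof -
    have sub: "set_pmf P \<subseteq> set_pmf Q"
      by (rule set_pmf_subset_if_exp_renyi_finite[where \<alpha> = \<alpha>, OF finP]) (simp add: d)
    have "d = renyi_sum \<alpha> P Q powr (1 / (\<alpha> - 1))"
      using exp_renyi_eq[OF finP sub, of \<alpha>] d by simp
    \<comment> \<open>The exponents \<open>1 / (\<alpha> - 1)\<close> and
      \<open>(\<alpha> - 1) / \<alpha>\<close> multiply to \<open>1 / \<alpha>\<close>.\<close>
    then have dr: "d powr r = renyi_sum \<alpha> P Q powr (1 / \<alpha>)"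
      using \<alpha> by (simp add: powr_powr r_def)
    have "A \<le> renyi_sum \<alpha> P Q powr (1 / \<alpha>) * exp_loss L Q H powr r * \<mu>"
      unfolding A_def r_def \<mu>_def using L0[OF Q] LM[OF Q]
      by (intro change_of_measure_exp_loss finP finQ[OF Q] sub \<alpha>) auto
    also have "\<dots> \<le> renyi_sum \<alpha> P Q powr (1 / \<alpha>) * c powr r * \<mu>"
    proof -
      have "0 \<le> exp_loss L Q H"
        unfolding exp_loss_def using L0[OF Q] by (auto intro!: sum_nonneg)
      then show ?thesis
        using loss[OF Q] r by (intro mult_right_mono mult_left_mono powr_mono2) (auto simp: \<mu>_def)
    qed
    also have "\<dots> = (c * d) powr r * \<mu>" using c d(2) by (simp add: powr_mult dr)
    finally show ?thesis .
  qed
  obtain Q0 where Q0: "Q0 \<in> \<C>" "exp_renyi \<alpha> P Q0 < \<top>"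
    using fin by (auto simp: exp_renyi_class_def INF_less_iff)
  show ?thesis
  \<comment> \<open>The inversion requires \<open>A\<close> and \<open>\<mu>\<close> to be positive.
    If \<open>\<mu> = 0\<close>, the bound at \<open>Q0\<close> forces \<open>A \<le> 0\<close>, and
    \<open>ennreal\<close> sends such an \<open>A\<close> to 0.\<close>
  proof (cases "A \<le> 0 \<or> \<mu> = 0")
    case True
    have "A \<le> 0"
      using True bound[OF Q0(1), of "enn2real (exp_renyi \<alpha> P Q0)"] Q0(2) by auto
    then show ?thesis by (simp add: A_def ennreal_neg)
  next
    case False
    then have A: "0 < A" and \<mu>: "0 < \<mu>" by (auto simp: \<mu>_def order.strict_iff_order)
    \<comment> \<open>The value of the divergence at which \<open>bound\<close> would be an
      equality.\<close>
    define t where "t = (A / \<mu>) powr (1 / r) / c"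
    have t: "0 \<le> t" using c by (simp add: t_def)
    have t_eq: "(c * t) powr r * \<mu> = A" using A \<mu> c r by (simp add: t_def powr_powr)
    have "ennreal t \<le> exp_renyi \<alpha> P Q" if Q: "Q \<in> \<C>" for Q
    proof (cases "exp_renyi \<alpha> P Q")
      case (real d)
      have "A / \<mu> \<le> (c * d) powr r" using bound[OF Q real(2,1)] \<mu> by (simp add: field_simps)
      then have "(A / \<mu>) powr (1 / r) \<le> ((c * d) powr r) powr (1 / r)"
        using A \<mu> r by (intro powr_mono2) auto
      then have "t \<le> d" using c r real(1) by (simp add: powr_powr t_def field_simps)
      then show ?thesis by (simp add: real ennreal_leI)
    qed simp
    then have "ennreal t \<le> exp_renyi_class \<alpha> P \<C>"
      unfolding exp_renyi_class_def by (rule INF_greatest)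
    then obtain d where d: "exp_renyi_class \<alpha> P \<C> = ennreal d" "t \<le> d"
      using fin t by (cases "exp_renyi_class \<alpha> P \<C>") auto
    have "A \<le> (c * d) powr r * \<mu>"
      unfolding t_eq[symmetric] using d(2) t c r \<mu> by (intro mult_right_mono powr_mono2) auto
    then have "ennreal A \<le> ennreal ((c * d) powr r) * ennreal \<mu>"
      by (simp add: ennreal_leI flip: ennreal_mult')
    moreover have "ennreal c * exp_renyi_class \<alpha> P \<C> = ennreal (c * d)"
      using c by (simp add: d ennreal_mult')
    moreover have "0 \<le> c * d" using c t d by simp
    ultimately show ?thesis by (simp add: A_def r_def \<mu>_def)
  qed
qed

section \<open>Combining the robust weights with the divergence bounds\<close>

lemma convex_on_weighted_sum:
  fixes f :: "'i \<Rightarrow> 'a::real_vector \<Rightarrow> real"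
  assumes "finite S" "convex Y" "\<And>i. i \<in> S \<Longrightarrow> 0 \<le> c i" "\<And>i. i \<in> S \<Longrightarrow> convex_on Y (f i)"
  shows "convex_on Y (\<lambda>a. \<Sum>i\<in>S. c i * f i a)"
  using assms by (induction S rule: finite_induct) (auto simp: convex_on_def[of _ "\<lambda>_. 0"] intro!: convex_on_add convex_on_cmul)

theorem theorem6:
  fixes p :: nat
    and Y :: "real set"
    and L :: "real \<Rightarrow> real \<Rightarrow> real"
    and D :: "nat \<Rightarrow> ('x::finite \<times> real) pmf"
    and C :: "nat \<Rightarrow> 'x \<Rightarrow> real pmf"
    and h :: "nat \<Rightarrow> 'x \<Rightarrow> real"
    and DT :: "('x \<times> real) pmf"
    and CT :: "'x \<Rightarrow> real pmf"
    and \<epsilon> M \<delta> :: real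
  assumes "p \<ge> 1" and "Y \<noteq> {}" and "convex Y"
    and "continuous_on (Y \<times> Y) (\<lambda>(a, b). L a b)"
    and "\<And>b. b \<in> Y \<Longrightarrow> convex_on Y (\<lambda>a. L a b)"
    and "\<And>a b. a \<in> Y \<Longrightarrow> b \<in> Y \<Longrightarrow> 0 \<le> L a b"
    and "\<And>k. k \<in> {1..p} \<Longrightarrow> fin_dist (UNIV \<times> Y) (D k)"
    and "\<And>k x. k \<in> {1..p} \<Longrightarrow> fin_dist Y (C k x)"
    and "\<And>k x y. k \<in> {1..p} \<Longrightarrow> pmf (D k) (x, y) = pmf (marg (D k)) x * pmf (C k x) y"
    and "fin_dist (UNIV \<times> Y) DT"
    and "\<And>x. fin_dist Y (CT x)"
    and "\<And>x y. pmf DT (x, y) = pmf (marg DT) x * pmf (CT x) y"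
    and "\<And>k x. k \<in> {1..p} \<Longrightarrow> h k x \<in> Y"
    and "\<epsilon> > 0" and "M \<ge> 0" and "\<delta> > 0"
    and "\<And>k. k \<in> {1..p} \<Longrightarrow> exp_loss L (D k) (h k) \<le> \<epsilon>"
    and "\<And>k x y. k \<in> {1..p} \<Longrightarrow> y \<in> Y \<Longrightarrow> L (h k x) y \<le> M"
  shows "\<exists>\<eta>>0. \<exists>z\<in>prob_simplex p. \<forall>\<alpha>>1.
           (\<forall>k\<in>{1..p}. \<forall>x\<in>set_pmf (marg (D k)). exp_renyi \<alpha> (CT x) (C k x) < \<top>) \<longrightarrow>
           exp_renyi_class \<alpha> DT (mixtures p (\<lambda>k. joint (marg (D k)) CT)) < \<top> \<longrightarrow>
           ennreal (exp_loss L DT (weighted_hyp p D h \<eta> z))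
             \<le> epowr ((eps_T p D C CT \<epsilon> M \<alpha> + ennreal \<delta>)
                      * exp_renyi_class \<alpha> DT (mixtures p (\<lambda>k. joint (marg (D k)) CT)))
                     ((\<alpha> - 1) / \<alpha>)
               * ennreal (M powr (1 / \<alpha>))"
proof -
  note p = assms(1) and Y = assms(3) and contL = assms(4) and convL = assms(5) and L0 = assms(6)
    and hY = assms(13) and LM = assms(18)
  define E where "E k = joint (marg (D k)) CT" for k
  define ls where "ls x a = (\<Sum>y\<in>set_pmf (CT x). pmf (CT x) y * L a y)" for x a
  \<comment> \<open>\<open>B\<close> is free of \<open>\<alpha>\<close>: the weights are chosen
    against \<open>B\<close>, and \<open>B\<close> is compared with \<open>eps_T\<close> only once
    \<open>\<alpha>\<close> is given.\<close>
  define B where "B = (MAX k\<in>{1..p}. exp_loss L (E k) (h k))"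
  have finCT: "finite (set_pmf (CT x))" and CTY: "set_pmf (CT x) \<subseteq> Y" for x
    using assms(11)[of x] by (auto simp: fin_dist_def)
  have finC: "finite (set_pmf (C k x))" if "k \<in> {1..p}" for k x
    using assms(8)[OF that] by (auto simp: fin_dist_def)
  have finE: "finite (set_pmf (E k))" and EY: "set_pmf (E k) \<subseteq> UNIV \<times> Y" for k
    unfolding E_def set_pmf_joint using finCT CTY by auto
  have DY: "y \<in> Y" if "k \<in> {1..p}" "(x, y) \<in> set_pmf (D k)" for k x y
    using assms(7)[OF that(1)] that(2) by (auto simp: fin_dist_def)
  have D_joint: "D k = joint (marg (D k)) (C k)" if "k \<in> {1..p}" for k
    using assms(9)[OF that] by (intro pmf_eqI) (auto simp: pmf_joint)
  have loss_E: "exp_loss L (E k) H = (\<Sum>x\<in>UNIV. pmf (marg (D k)) x * ls x (H x))" for k H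
    unfolding E_def ls_def by (rule exp_loss_joint[OF finCT])
  have ls_cont: "continuous_on Y (ls x)" for x
  proof -
    have "continuous_on Y (\<lambda>a. L a y)" if "y \<in> Y" for y
    proof -
      have "continuous_on Y (\<lambda>a. (a, y))" "(\<lambda>a. (a, y)) ` Y \<subseteq> Y \<times> Y"
        using that by (auto intro!: continuous_intros)
      from continuous_on_compose2[OF contL this] show ?thesis by simp
    qed
    then show ?thesis unfolding ls_def using CTY by (intro continuous_intros) auto
  qed
  have ls_conv: "convex_on Y (ls x)" for x
    unfolding ls_def using CTY by (intro convex_on_weighted_sum finCT Y convL) auto
  have ls_nonneg: "0 \<le> ls x a" if "a \<in> Y" for x a
    unfolding ls_def using CTY L0[OF that] by (intro sum_nonneg mult_nonneg_nonneg) auto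
  have ls_le: "ls x (h k x) \<le> M" if "k \<in> {1..p}" for k x
  proof -
    have "ls x (h k x) \<le> (\<Sum>y\<in>set_pmf (CT x). pmf (CT x) y * M)"
      unfolding ls_def using CTY LM[OF that] by (intro sum_mono mult_left_mono) auto
    also have "\<dots> = M"
      by (simp add: sum_pmf_eq_1[OF finCT] flip: sum_distrib_right)
    finally show ?thesis .
  qed
  have le_B: "(\<Sum>x\<in>UNIV. pmf (marg (D k)) x * ls x (h k x)) \<le> B" if "k \<in> {1..p}" for k
    unfolding loss_E[symmetric] B_def using that by (intro Max_ge) auto
  have "\<exists>\<eta>>0. \<exists>z\<in>prob_simplex p. \<forall>k\<in>{1..p}.
          exp_loss L (E k) (weighted_hyp p D h \<eta> z) \<le> B + \<delta>"
    unfolding loss_E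
    by (rule exists_robust_weights[OF p Y])
      (fact ls_cont ls_conv ls_nonneg hY ls_le le_B \<open>\<delta> > 0\<close>)+
  then obtain \<eta> z where \<eta>: "\<eta> > 0" and z: "z \<in> prob_simplex p"
    and robust: "\<forall>k\<in>{1..p}. exp_loss L (E k) (weighted_hyp p D h \<eta> z) \<le> B + \<delta>"
    by blast
  define H where "H = weighted_hyp p D h \<eta> z"
  have HY: "H x \<in> Y" for x unfolding H_def by (rule weighted_hyp_mem[OF p \<eta> z Y hY])
  have HM: "L (H x) y \<le> M" if "y \<in> Y" for x y
    unfolding H_def by (rule weighted_hyp_le_bound[OF p \<eta> z convL[OF that] hY LM[OF _ that]])
  have main: "ennreal (exp_loss L DT H)
      \<le> epowr ((eps_T p D C CT \<epsilon> M \<alpha> + ennreal \<delta>) * exp_renyi_class \<alpha> DT (mixtures p E)) ((\<alpha> - 1) / \<alpha>)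
        * ennreal (M powr (1 / \<alpha>))"
    if \<alpha>: "\<alpha> > 1" and fin: "\<forall>k\<in>{1..p}. \<forall>x\<in>set_pmf (marg (D k)). exp_renyi \<alpha> (CT x) (C k x) < \<top>"
      and fin_class: "exp_renyi_class \<alpha> DT (mixtures p E) < \<top>" for \<alpha>
  proof -
    note eps = exp_loss_le_eps_T[OF p \<alpha> finC finCT D_joint L0[OF hY DY] LM[OF _ DY] assms(17)]
    have "eps_T p D C CT \<epsilon> M \<alpha> < \<top>" by (rule eps(1)) (use fin in auto)
    then obtain e where e: "eps_T p D C CT \<epsilon> M \<alpha> = ennreal e" "0 \<le> e"
      by (cases "eps_T p D C CT \<epsilon> M \<alpha>") auto
    have "exp_loss L (E k) (h k) \<le> e" if "k \<in> {1..p}" for k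
    proof -
      have "ennreal (exp_loss L (E k) (h k)) \<le> eps_T p D C CT \<epsilon> M \<alpha>"
        unfolding E_def by (rule eps(2)) (use fin that in auto)
      then show ?thesis using e by simp
    qed
    \<comment> \<open>Here the weights, already fixed, meet a particular \<open>\<alpha>\<close>:
      the bound \<open>B + \<delta>\<close> becomes \<open>e + \<delta>\<close>.\<close>
    then have "B \<le> e" unfolding B_def using p by (subst Max_le_iff) auto
    then have loss_H: "exp_loss L (E k) H \<le> e + \<delta>" if "k \<in> {1..p}" for k
      using robust that unfolding H_def by force
    have Q_supp: "set_pmf Q \<subseteq> (\<Union>k\<in>{1..p}. set_pmf (E k))" if "Q \<in> mixtures p E" for Q
      using that set_pmf_mixture unfolding mixtures_def by blast
    have QY: "y \<in> Y" if "Q \<in> mixtures p E" "(x, y) \<in> set_pmf Q" for Q x y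
      using Q_supp[OF that(1)] that(2) EY by blast
    have "ennreal (exp_loss L DT H)
        \<le> epowr (ennreal (e + \<delta>) * exp_renyi_class \<alpha> DT (mixtures p E)) ((\<alpha> - 1) / \<alpha>)
          * ennreal (M powr (1 / \<alpha>))"
    proof (rule exp_loss_le_exp_renyi_class[OF \<alpha>])
      show "e + \<delta> > 0" using e \<open>\<delta> > 0\<close> by simp
      show "finite (set_pmf DT)" using assms(10) by (simp add: fin_dist_def)
      fix Q assume Q: "Q \<in> mixtures p E"
      show "finite (set_pmf Q)"
        by (rule finite_subset[OF Q_supp[OF Q]]) (intro finite_UN_I finite_atLeastAtMost finE)
      show "0 \<le> L (H x) y" "L (H x) y \<le> M" if "(x, y) \<in> set_pmf Q" for x y
        using QY[OF Q that] L0 HY HM by auto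
      obtain l where l: "l \<in> prob_simplex p" and Ql: "\<And>w. pmf Q w = (\<Sum>k=1..p. l k * pmf (E k) w)"
        using Q by (auto simp: mixtures_def)
      \<comment> \<open>By linearity the bound for the \<open>E k\<close> passes to every mixture
        with the same constant, so the infimum can range over the whole class.\<close>
      have "exp_loss L Q H = (\<Sum>k=1..p. l k * exp_loss L (E k) H)"
        by (rule exp_loss_mixture[OF finE Ql])
      also have "\<dots> \<le> (\<Sum>k=1..p. l k * (e + \<delta>))"
        by (intro sum_mono mult_left_mono loss_H prob_simplex_nonneg[OF l])
      also have "\<dots> = e + \<delta>"
        using prob_simplex_sum[OF l] by (simp flip: sum_distrib_right)
      finally show "exp_loss L Q H \<le> e + \<delta>" .
    qed (rule fin_class)
    then show ?thesis using e \<open>\<delta> > 0\<close> by (simp add: ennreal_plus)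
  qed
  show ?thesis
    using \<eta> z main unfolding H_def E_def[abs_def] by blast
qed

end
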